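(* Let $(X,d)$ be a complete $b$-metric space with coefficient $s \geq 1$. For each $i\in\mathbb{N}_0$ let $T_i:X\to X$ be a weak quasi-contraction, and suppose that $$\operatorname{diam}\mathcal{O}_{T_j}(T_ix,T_iy)\leq\operatorname{diam}\mathcal{O}_{T_j}(x,y)\quad\text{for all } x,y\in X,\ i,j\in\mathbb{N}_0.$$ Let $\mathfrak{F}$ be a set of mappings $f:\mathbb{N}_0\to\mathbb{N}_0$ with the shift property: if $f\in\mathfrak{F}$ and $p\in\mathbb{N}$, then $f_p\in\mathfrak{F}$, where $f_p(i)=f(i+p)$ for all $i\in\mathbb{N}_0$. Suppose that for each $\epsilon>0$ there exists a natural number $n_\epsilon$ such that for each $f\in\mathfrak{F}$ and each $x,y\in X$, $$d(T_{f(n_\epsilon)}T_{f(n_\epsilon-1)}\cdots T_{f(1)}T_{f(0)}x,\;T_{f(n_\epsilon)}T_{f(n_\epsilon-1)}\cdots T_{f(1)}T_{f(0)}y)<\epsilon.$$ Then for each $\epsilon>0$ there exist $\delta>0$ and $n\in\mathbb{N}$ such that for each $f\in\mathfrak{F}$ and each pair of sequences $\{x_i\}_{i=0}^\infty,\{y_i\}_{i=0}^\infty\subset X$ satisfying $$\operatorname{diam}\mathcal{O}_{T_{f(j)}}(x_{i+1},T_{f(i)}x_i)\leq\delta\quad\text{and}\quad \operatorname{diam}\mathcal{O}_{T_{f(j)}}(y_{i+1},T_{f(i)}y_i)\leq\delta\quad\text{for all } i,j\in\mathbb{N}_0,$$ one has $d(x_i,y_i)<\epsilon$ for all $i\geq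 n$.
   Context: $\mathbb{N}$ is the set of natural numbers (positive integers) and $\mathbb{N}_0=\mathbb{N}\cup\{0\}$. A $b$-metric space with coefficient $s\geq1$ is a nonempty set $X$ with $d:X\times X\to[0,\infty)$ such that for all $x,y,z\in X$: $d(x,y)=0$ iff $x=y$; $d(x,y)=d(y,x)$; $d(x,y)\leq s[d(x,z)+d(z,y)]$. A sequence $\{x_n\}$ converges to $x$ iff $d(x_n,x)\to0$; it is Cauchy iff $d(x_n,x_m)\to0$ as $n,m\to\infty$; $(X,d)$ is complete if every Cauchy sequence converges in $X$. For $T:X\to X$: $T^0$ is the identity, $T^{n+1}=T\circ T^n$, $\mathcal{O}_T(x)=\{T^nx:n\in\mathbb{N}_0\}$, $\mathcal{O}_T(x,y)=\mathcal{O}_T(x)\cup\mathcal{O}_T(y)$; $\operatorname{diam}A=\sup\{d(u,v):u,v\in A\}$. $T$ is a weak quasi-contraction if every orbit $\mathcal{O}_T(x)$ is bounded and $d(Tx,Ty)\leq\psi(\operatorname{diam}\mathcal{O}_T(x,y))$ for all $x,y\in X$, for some $\psi:[0,\infty)\to[0,\infty)$ that is increasing and upper semi-continuous with $\psi(0)=0$ and $\psi(t)<t$ for all $t>0$. *)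

theory Defs
  imports Complex_Main "HOL-Library.FuncSet"
begin

locale b_metric_space =
  fixes X :: "'a set" and d :: "'a \<Rightarrow> 'a \<Rightarrow> real" and s :: real
  assumes coeff_ge_1: "1 \<le> s"
    and nonempty: "X \<noteq> {}"
    and nonneg: "\<lbrakk>x \<in> X; y \<in> X\<rbrakk> \<Longrightarrow> 0 \<le> d x y"
    and eq_0_iff: "\<lbrakk>x \<in> X; y \<in> X\<rbrakk> \<Longrightarrow> d x y = 0 \<longleftrightarrow> x = y"
    and commute: "\<lbrakk>x \<in> X; y \<in> X\<rbrakk> \<Longrightarrow> d x y = d y x"
    and b_triangle: "\<lbrakk>x \<in> X; y \<in> X; z \<in> X\<rbrakk> \<Longrightarrow> d x y \<le> s * (d x z + d z y)"

definition b_converges :: "('a \<Rightarrow> 'a \<Rightarrow> real) \<Rightarrow> (nat \<Rightarrow> 'a) \<Rightarrow> 'a \<Rightarrow> bool" where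
  "b_converges d u l \<longleftrightarrow> (\<lambda>n. d (u n) l) \<longlonglongrightarrow> 0"

definition b_Cauchy :: "('a \<Rightarrow> 'a \<Rightarrow> real) \<Rightarrow> (nat \<Rightarrow> 'a) \<Rightarrow> bool" where
  "b_Cauchy d u \<longleftrightarrow> ((\<lambda>(n, m). d (u n) (u m)) \<longlongrightarrow> 0) (sequentially \<times>\<^sub>F sequentially)"

locale complete_b_metric_space = b_metric_space +
  assumes complete:
    "\<lbrakk>\<And>n. u n \<in> X; b_Cauchy d u\<rbrakk> \<Longrightarrow> \<exists>l\<in>X. b_converges d u l"

definition orbit1 :: "('a \<Rightarrow> 'a) \<Rightarrow> 'a \<Rightarrow> 'a set" where
  "orbit1 T x = {(T ^^ n) x | n :: nat. True}"

definition orbit2 :: "('a \<Rightarrow> 'a) \<Rightarrow> 'a \<Rightarrow> 'a \<Rightarrow> 'a set" where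
  "orbit2 T x y = orbit1 T x \<union> orbit1 T y"

definition b_bounded :: "('a \<Rightarrow> 'a \<Rightarrow> real) \<Rightarrow> 'a set \<Rightarrow> bool" where
  "b_bounded d A \<longleftrightarrow> (\<exists>M. \<forall>u\<in>A. \<forall>v\<in>A. d u v \<le> M)"

(* The real-valued supremum is meaningful only for nonempty bounded A.  If the orbits of T
   are bounded, then so is every orbit2 T x y, by the relaxed triangle inequality. *)
definition b_diam :: "('a \<Rightarrow> 'a \<Rightarrow> real) \<Rightarrow> 'a set \<Rightarrow> real" where
  "b_diam d A = Sup {d u v | u v. u \<in> A \<and> v \<in> A}"

definition upper_semicontinuous_on :: "real set \<Rightarrow> (real \<Rightarrow> real) \<Rightarrow> bool" where
  "upper_semicontinuous_on S f \<longleftrightarrow>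
     (\<forall>t\<in>S. \<forall>y. f t < y \<longrightarrow> (\<forall>\<^sub>F u in at t within S. f u < y))"

definition weak_quasi_contraction ::
    "'a set \<Rightarrow> ('a \<Rightarrow> 'a \<Rightarrow> real) \<Rightarrow> ('a \<Rightarrow> 'a) \<Rightarrow> bool" where
  "weak_quasi_contraction X d T \<longleftrightarrow>
     T \<in> X \<rightarrow> X \<and>
     (\<forall>x\<in>X. b_bounded d (orbit1 T x)) \<and>
     (\<exists>\<psi> :: real \<Rightarrow> real.
        \<psi> \<in> {0..} \<rightarrow> {0..} \<and>
        mono_on {0..} \<psi> \<and>
        upper_semicontinuous_on {0..} \<psi> \<and>
        \<psi> 0 = 0 \<and>
        (\<forall>t>0. \<psi> t < t) \<and>
        (\<forall>x\<in>X. \<forall>y\<in>X. d (T x) (T y) \<le> \<psi> (b_diam d (orbit2 T x y))))"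

(* comp_upto T f n = T (f n) o ... o T (f 1) o T (f 0), with n + 1 factors *)
primrec comp_upto :: "(nat \<Rightarrow> 'a \<Rightarrow> 'a) \<Rightarrow> (nat \<Rightarrow> nat) \<Rightarrow> nat \<Rightarrow> 'a \<Rightarrow> 'a" where
  "comp_upto T f 0 = T (f 0)"
| "comp_upto T f (Suc n) = T (f (Suc n)) \<circ> comp_upto T f n"

definition shift_property :: "(nat \<Rightarrow> nat) set \<Rightarrow> bool" where
  "shift_property F \<longleftrightarrow> (\<forall>f\<in>F. \<forall>p\<ge>1. (\<lambda>i. f (i + p)) \<in> F)"

end

theory Submission
  imports Defs
begin

text \<open>
  Write $D_j(u,v)$ for the diameter of the joint orbit of $u$ and $v$ under $T_{f(j)}$. It obeys the
  relaxed triangle inequality, and by hypothesis no $T_i$ increases it. Hence along a block of fixed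
  length the distance between an inexact trajectory and the exact one started at the same point is
  at most a constant times $\delta$; the constant depends only on $s$ and the block length. The
  exact trajectories of the last block before time $i$, started at arbitrary points, end close
  together by the uniform hypothesis, applied to a shift of $f$.
\<close>

lemma self_in_orbit1: "x \<in> orbit1 T x"
  unfolding orbit1_def by (auto intro: exI[of _ "0 :: nat"])

lemma self_in_orbit2: "x \<in> orbit2 T x y" "y \<in> orbit2 T x y"
  unfolding orbit2_def by (simp_all add: self_in_orbit1)

lemma orbit1_subset:
  assumes "T \<in> X \<rightarrow> X" "x \<in> X"
  shows "orbit1 T x \<subseteq> X"
proof -
  have "(T ^^ n) x \<in> X" for n
    using assms by (induction n) auto
  then show ?thesis
    unfolding orbit1_def by auto
qed

lemma comp_upto_in:
  assumes "\<And>i. T i \<in> X \<rightarrow> X" "x \<in> X"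
  shows "comp_upto T f n x \<in> X"
  using assms by (induction n) (auto simp: Pi_iff)

lemma b_diam_le:
  assumes "A \<noteq> {}" "\<And>u v. \<lbrakk>u \<in> A; v \<in> A\<rbrakk> \<Longrightarrow> d u v \<le> M"
  shows "b_diam d A \<le> M"
  unfolding b_diam_def using assms by (intro cSup_least) blast+

text \<open>Boundedness is what makes \<open>Sup\<close> an actual upper bound here; every later use
  has to supply it for a joint orbit.\<close>

lemma dist_le_b_diam:
  assumes "b_bounded d A" "u \<in> A" "v \<in> A"
  shows "d u v \<le> b_diam d A"
proof -
  have "bdd_above {d u v | u v. u \<in> A \<and> v \<in> A}"
    using assms(1) unfolding b_bounded_def bdd_above_def by blast
  then show ?thesis
    unfolding b_diam_def using assms(2,3) by (intro cSup_upper) auto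
qed

context b_metric_space
begin

text \<open>Points of different orbits are joined through the two base points, whose distance is
  fixed; the bounds of the single orbits control the two ends.\<close>

lemma b_bounded_orbit2:
  assumes T: "T \<in> X \<rightarrow> X" and bounded: "\<And>x. x \<in> X \<Longrightarrow> b_bounded d (orbit1 T x)"
    and x: "x \<in> X" and y: "y \<in> X"
  shows "b_bounded d (orbit2 T x y)"
proof -
  obtain M where M: "\<And>u v. \<lbrakk>u \<in> orbit1 T x; v \<in> orbit1 T x\<rbrakk> \<Longrightarrow> d u v \<le> M"
    using bounded[OF x] unfolding b_bounded_def by blast
  obtain M' where M': "\<And>u v. \<lbrakk>u \<in> orbit1 T y; v \<in> orbit1 T y\<rbrakk> \<Longrightarrow> d u v \<le> M'"
    using bounded[OF y] unfolding b_bounded_def by blast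
  \<comment> \<open>Two relaxed triangle inequalities along the path from \<open>u\<close> via
    \<open>x\<close> and \<open>y\<close> to \<open>v\<close>.\<close>
  define K where "K = s * (M + s * (d x y + M'))"
  have sub: "orbit1 T x \<subseteq> X" "orbit1 T y \<subseteq> X"
    using orbit1_subset[OF T] x y by auto
  have cross: "d u v \<le> K" if u: "u \<in> orbit1 T x" and v: "v \<in> orbit1 T y" for u v
  proof -
    have "d u v \<le> s * (d u x + d x v)"
      using b_triangle u v x sub by blast
    also have "\<dots> \<le> s * (M + s * (d x y + d y v))"
      using M[OF u self_in_orbit1] b_triangle[of x v y] x y v sub coeff_ge_1
      by (intro mult_left_mono add_mono) auto
    also have "\<dots> \<le> K"
      unfolding K_def using M'[OF self_in_orbit1 v] coeff_ge_1
      by (intro mult_left_mono add_mono) auto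
    finally show ?thesis .
  qed
  have "d u v \<le> max K (max M M')" if "u \<in> orbit2 T x y" "v \<in> orbit2 T x y" for u v
  proof -
    have "d v u = d u v"
      using commute that sub unfolding orbit2_def by blast
    then show ?thesis
      using that M[of u v] M'[of u v] cross[of u v] cross[of v u] unfolding orbit2_def by fastforce
  qed
  then show ?thesis
    unfolding b_bounded_def by blast
qed

text \<open>The point \<open>z\<close> lies in both joint orbits on the right, so a pair from
  different orbits is compared through \<open>z\<close>. A pair from one orbit already lies in one
  of these joint orbits.\<close>

lemma b_diam_orbit2_triangle:
  assumes T: "T \<in> X \<rightarrow> X" and bounded: "\<And>x. x \<in> X \<Longrightarrow> b_bounded d (orbit1 T x)"
    and x: "x \<in> X" and y: "y \<in> X" and z: "z \<in> X"
  shows "b_diam d (orbit2 T x y) \<le> s * (b_diam d (orbit2 T x z) + b_diam d (orbit2 T z y))"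
    (is "_ \<le> s * (?a + ?b)")
proof (rule b_diam_le)
  show "orbit2 T x y \<noteq> {}"
    using self_in_orbit2 by fastforce
next
  have sub: "orbit1 T x \<subseteq> X" "orbit1 T y \<subseteq> X"
    using orbit1_subset[OF T] x y by auto
  have a: "d u v \<le> ?a" if "u \<in> orbit2 T x z" "v \<in> orbit2 T x z" for u v
    using dist_le_b_diam[OF b_bounded_orbit2[OF T bounded]] x z that by blast
  have b: "d u v \<le> ?b" if "u \<in> orbit2 T z y" "v \<in> orbit2 T z y" for u v
    using dist_le_b_diam[OF b_bounded_orbit2[OF T bounded]] y z that by blast
  have nonneg_ab: "0 \<le> ?a" "0 \<le> ?b"
    using a[of x x] b[of y y] nonneg[of x x] nonneg[of y y] x y self_in_orbit2 by fastforce+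
  \<comment> \<open>For pairs from one orbit, where only \<open>?a\<close> or \<open>?b\<close>
    appears as bound.\<close>
  have scale: "?a + ?b \<le> s * (?a + ?b)"
    using mult_right_mono[OF coeff_ge_1, of "?a + ?b"] nonneg_ab by simp
  have cross: "d u v \<le> s * (?a + ?b)" if u: "u \<in> orbit1 T x" and v: "v \<in> orbit1 T y" for u v
  proof -
    have "d u v \<le> s * (d u z + d z v)"
      using b_triangle u v z sub by blast
    also have "\<dots> \<le> s * (?a + ?b)"
      using u v coeff_ge_1 self_in_orbit1[of z T]
      by (intro mult_left_mono add_mono a b) (auto simp: orbit2_def)
    finally show ?thesis .
  qed
  fix u v assume uv: "u \<in> orbit2 T x y" "v \<in> orbit2 T x y"
  then consider "u \<in> orbit1 T x" "v \<in> orbit1 T x" | "u \<in> orbit1 T y" "v \<in> orbit1 T y"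
    | "u \<in> orbit1 T x" "v \<in> orbit1 T y" | "u \<in> orbit1 T y" "v \<in> orbit1 T x"
    unfolding orbit2_def by blast
  then show "d u v \<le> s * (?a + ?b)"
  proof cases
    case 1
    then show ?thesis
      using a[of u v] nonneg_ab scale unfolding orbit2_def by auto
  next
    case 2
    then show ?thesis
      using b[of u v] nonneg_ab scale unfolding orbit2_def by auto
  next
    case 3
    then show ?thesis by (rule cross)
  next
    case 4
    then show ?thesis
      using cross[of v u] commute[of u v] sub by (metis subsetD)
  qed
qed

text \<open>The induction starts after one step because $D_j(x_0,x_0)$, the diameter
  of a single orbit, need not be small.\<close>

lemma b_diam_orbit2_inexact_exact_le:
  assumes T: "\<And>i. T i \<in> X \<rightarrow> X"
    and bounded: "\<And>i x. x \<in> X \<Longrightarrow> b_bounded d (orbit1 (T i) x)"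
    and nonexpansive: "\<And>x y i j. \<lbrakk>x \<in> X; y \<in> X\<rbrakk> \<Longrightarrow>
      b_diam d (orbit2 (T j) (T i x) (T i y)) \<le> b_diam d (orbit2 (T j) x y)"
    and x: "\<And>i. x i \<in> X"
    and step: "\<And>i. b_diam d (orbit2 (T j) (x (Suc i)) (T (f i) (x i))) \<le> \<delta>"
  shows "b_diam d (orbit2 (T j) (x (Suc n)) (comp_upto T f n (x 0)))
    \<le> ((\<lambda>c. s * (1 + c)) ^^ n) 1 * \<delta>"
proof (induction n)
  case 0
  show ?case using step[of 0] by simp
next
  case (Suc n)
  let ?z = "comp_upto T f n (x 0)" and ?D = "\<lambda>u v. b_diam d (orbit2 (T j) u v)"
  let ?C = "((\<lambda>c. s * (1 + c)) ^^ n) 1" and ?S = "T (f (Suc n))"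
  have z: "?z \<in> X"
    using comp_upto_in[of T, OF T x] .
  have S: "?S u \<in> X" if "u \<in> X" for u
    using T[of "f (Suc n)"] that by auto
  \<comment> \<open>Passing through \<open>?S (x (Suc n))\<close> separates the newest error, at
    most \<delta>, from the old one, which \<open>?S\<close> does not increase. Hence the error
    factor c becomes \<open>s * (1 + c)\<close>.\<close>
  have "?D (x (Suc (Suc n))) (?S ?z) \<le> s * (?D (x (Suc (Suc n))) (?S (x (Suc n)))
      + ?D (?S (x (Suc n))) (?S ?z))"
    using b_diam_orbit2_triangle[OF T bounded] x z S by blast
  also have "\<dots> \<le> s * (\<delta> + ?C * \<delta>)"
    using step[of "Suc n"] order_trans[OF nonexpansive[OF x z] Suc.IH] coeff_ge_1
    by (intro mult_left_mono add_mono) auto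
  also have "\<dots> = s * (1 + ?C) * \<delta>"
    by (simp add: algebra_simps)
  finally show ?case by simp
qed

end

theorem theorem3p1:
  fixes X :: "'a set" and d :: "'a \<Rightarrow> 'a \<Rightarrow> real" and s :: real
    and T :: "nat \<Rightarrow> 'a \<Rightarrow> 'a" and F :: "(nat \<Rightarrow> nat) set"
  assumes "complete_b_metric_space X d s"
    and "\<And>i. weak_quasi_contraction X d (T i)"
    and "\<And>x y i j. \<lbrakk>x \<in> X; y \<in> X\<rbrakk> \<Longrightarrow>
           b_diam d (orbit2 (T j) (T i x) (T i y)) \<le> b_diam d (orbit2 (T j) x y)"
    and "shift_property F"
    and "\<And>\<epsilon> :: real. \<epsilon> > 0 \<Longrightarrow>
           \<exists>N\<ge>1. \<forall>f\<in>F. \<forall>x\<in>X. \<forall>y\<in>X. d (comp_upto T f N x) (comp_upto T f N y) < \<epsilon>"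
  shows "\<forall>\<epsilon> :: real. \<epsilon> > 0 \<longrightarrow>
           (\<exists>\<delta>>0. \<exists>n\<ge>1. \<forall>f\<in>F. \<forall>x y :: nat \<Rightarrow> 'a.
              (\<forall>i. x i \<in> X) \<longrightarrow> (\<forall>i. y i \<in> X) \<longrightarrow>
              (\<forall>i j. b_diam d (orbit2 (T (f j)) (x (Suc i)) (T (f i) (x i))) \<le> \<delta>) \<longrightarrow>
              (\<forall>i j. b_diam d (orbit2 (T (f j)) (y (Suc i)) (T (f i) (y i))) \<le> \<delta>) \<longrightarrow>
              (\<forall>i\<ge>n. d (x i) (y i) < \<epsilon>))"
proof (intro allI impI)
  interpret complete_b_metric_space X d s by fact
  fix \<epsilon> :: real assume "\<epsilon> > 0"
  have T: "T i \<in> X \<rightarrow> X" and bounded: "x \<in> X \<Longrightarrow> b_bounded d (orbit1 (T i) x)" for i x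
    using assms(2) unfolding weak_quasi_contraction_def by blast+
  \<comment> \<open>The final estimate is \<open>3 * s\<^sup>2 * \<eta>\<close>, so the factor 4
    leaves strict room below \<epsilon>.\<close>
  define \<eta> where "\<eta> = \<epsilon> / (4 * s\<^sup>2)"
  have "\<eta> > 0"
    unfolding \<eta>_def using \<open>\<epsilon> > 0\<close> coeff_ge_1 by simp
  then obtain N where N: "\<And>f x y. \<lbrakk>f \<in> F; x \<in> X; y \<in> X\<rbrakk> \<Longrightarrow>
      d (comp_upto T f N x) (comp_upto T f N y) < \<eta>"
    using assms(5) by blast
  define C where "C = ((\<lambda>c. s * (1 + c)) ^^ N) 1"
  have "((\<lambda>c. s * (1 + c)) ^^ n) 1 > 0" for n
    using coeff_ge_1 by (induction n) auto
  then have "C > 0"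
    unfolding C_def .
  \<comment> \<open>\<open>C * \<delta>\<close> bounds the error accumulated over one block, which
    is thus at most \<eta>.\<close>
  define \<delta> where "\<delta> = \<eta> / C"
  have "\<delta> > 0"
    unfolding \<delta>_def using \<open>\<eta> > 0\<close> \<open>C > 0\<close> by simp
  \<comment> \<open>The block that starts at time \<open>m\<close> has \<open>Suc N\<close> steps,
    since \<open>comp_upto T f N\<close> has \<open>N + 1\<close> factors.\<close>
  have track: "d (x (m + Suc N)) (comp_upto T (\<lambda>i. f (i + m)) N (x m)) \<le> \<eta>"
    if x: "\<forall>i. x i \<in> X"
      and step: "\<forall>i j. b_diam d (orbit2 (T (f j)) (x (Suc i)) (T (f i) (x i))) \<le> \<delta>"
    for f x m
  proof -
    let ?x = "\<lambda>i. x (i + m)" and ?f = "\<lambda>i. f (i + m)"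
    let ?z = "comp_upto T ?f N (x m)"
    have "?z \<in> X"
      using comp_upto_in[of T, OF T] x by blast
    \<comment> \<open>Both points lie in their joint orbit under \<open>T (f 0)\<close>, whose
      diameter \<open>step\<close> controls.\<close>
    then have "d (?x (Suc N)) ?z \<le> b_diam d (orbit2 (T (f 0)) (?x (Suc N)) ?z)"
      using x by (intro dist_le_b_diam b_bounded_orbit2 self_in_orbit2 T bounded) auto
    also have "\<dots> \<le> C * \<delta>"
      using b_diam_orbit2_inexact_exact_le[of T ?x "f 0" ?f \<delta> N] T bounded assms(3) x step
      unfolding C_def by simp
    also have "\<dots> = \<eta>"
      unfolding \<delta>_def using \<open>C > 0\<close> by simp
    finally show ?thesis
      by (simp add: add.commute)
  qed
  show "\<exists>\<delta>>0. \<exists>n\<ge>1. \<forall>f\<in>F. \<forall>x y :: nat \<Rightarrow> 'a.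
          (\<forall>i. x i \<in> X) \<longrightarrow> (\<forall>i. y i \<in> X) \<longrightarrow>
          (\<forall>i j. b_diam d (orbit2 (T (f j)) (x (Suc i)) (T (f i) (x i))) \<le> \<delta>) \<longrightarrow>
          (\<forall>i j. b_diam d (orbit2 (T (f j)) (y (Suc i)) (T (f i) (y i))) \<le> \<delta>) \<longrightarrow>
          (\<forall>i\<ge>n. d (x i) (y i) < \<epsilon>)"
  \<comment> \<open>From time \<open>Suc N\<close> on, a full block fits before the current
    time.\<close>
  proof (rule exI[of _ \<delta>], intro conjI \<open>\<delta> > 0\<close>, rule exI[of _ "Suc N"],
      intro conjI ballI allI impI)
    fix f x y i
    assume f: "f \<in> F" and x: "\<forall>i. x i \<in> X" and y: "\<forall>i. y i \<in> X"
      and stepx: "\<forall>i j. b_diam d (orbit2 (T (f j)) (x (Suc i)) (T (f i) (x i))) \<le> \<delta>"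
      and stepy: "\<forall>i j. b_diam d (orbit2 (T (f j)) (y (Suc i)) (T (f i) (y i))) \<le> \<delta>"
      and i: "Suc N \<le> i"
    define m where "m = i - Suc N"
    have i_eq: "i = m + Suc N"
      unfolding m_def using i by simp
    define g where "g = (\<lambda>i. f (i + m))"
    have "g \<in> F"
      \<comment> \<open>The shift property covers only \<open>m \<ge> 1\<close>; for
        \<open>m = 0\<close>, \<open>g\<close> is \<open>f\<close> itself.\<close>
      using assms(4) f unfolding shift_property_def g_def by (cases "m = 0") auto
    define u where "u = comp_upto T g N (x m)"
    define v where "v = comp_upto T g N (y m)"
    have uv: "u \<in> X" "v \<in> X"
      unfolding u_def v_def using comp_upto_in[of T, OF T] x y by blast+
    have xu: "d (x i) u \<le> \<eta>" and "d (y i) v \<le> \<eta>"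
      unfolding i_eq u_def v_def g_def using track x y stepx stepy by blast+
    then have vy: "d v (y i) \<le> \<eta>"
      using commute y uv by simp
    \<comment> \<open>The extra factor \<open>s\<close> makes all three terms of the chain via
      \<open>u\<close> and \<open>v\<close> multiples of \<open>s * \<eta>\<close>, so that
      \<open>s\<^sup>2\<close> cancels in the end.\<close>
    have xu_scaled: "d (x i) u \<le> s * \<eta>"
      using xu mult_right_mono[OF coeff_ge_1, of \<eta>] \<open>\<eta> > 0\<close> by linarith
    have uv_less: "d u v < \<eta>"
      unfolding u_def v_def using N \<open>g \<in> F\<close> x y by blast
    have "d (x i) (y i) \<le> s * (d (x i) u + d u (y i))"
      using b_triangle x y uv by blast
    also have "\<dots> \<le> s * (d (x i) u + s * (d u v + d v (y i)))"
      using b_triangle[of u "y i" v] y uv coeff_ge_1 by (intro mult_left_mono add_left_mono) auto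
    also have "\<dots> \<le> s * (s * \<eta> + s * (\<eta> + \<eta>))"
      using xu_scaled vy uv_less coeff_ge_1
      by (intro mult_left_mono add_mono) auto
    also have "\<dots> = 3 / 4 * \<epsilon>"
      unfolding \<eta>_def using coeff_ge_1 by (simp add: field_simps power2_eq_square)
    also have "\<dots> < \<epsilon>"
      using \<open>\<epsilon> > 0\<close> by simp
    finally show "d (x i) (y i) < \<epsilon>" .
  qed simp
qed

end
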